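(* For every $k\geq2$, $$H_{12\mbox{-}3\mbox{-}\cdots\mbox{-}k}(x)=\frac{x}{U_k^2\left(\frac{1}{2\sqrt{x}}\right)}\sum_{j=1}^{k-2}U_j^2\left(\frac{1}{2\sqrt{x}}\right)$$ (for $k=2$ the pattern is $12$ and the sum is empty).
   Context: A generalized pattern is a permutation of $\{1,\dots,k\}$ written as a word $\tau_1\cdots\tau_k$ in which each pair of adjacent letters may or may not be separated by a dash "-". An occurrence of $\tau$ in $\pi=\pi_1\cdots\pi_n\in S_n$ is a choice of indices $i_1<\dots<i_k$ with $(\pi_{i_1},\dots,\pi_{i_k})$ order-isomorphic to $(\tau_1,\dots,\tau_k)$ and $i_{j+1}=i_j+1$ whenever $\tau_j,\tau_{j+1}$ are not separated by a dash; $\pi$ avoids $\tau$ if there is no occurrence. $1\mbox{-}3\mbox{-}2$ is the classical pattern $132$. $H_\tau(x)=\sum_{n\geq0}h_\tau(n)x^n$ where $h_\tau(n)$ is the number of permutations in $S_n$ avoiding $\tau$ and containing exactly one occurrence of $1\mbox{-}3\mbox{-}2$. $U_p$ is the Chebyshev polynomial of the second kind, $U_p(\cos\theta)=\sin((p+1)\theta)/\sin\theta$. *)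

theory Defs
  imports
    "HOL-Analysis.Analysis"
    "HOL-Computational_Algebra.Computational_Algebra"
    "HOL-Combinatorics.Multiset_Permutations"
begin

text \<open>
  A generalized pattern is a pair of its word \<open>\<tau>\<^sub>1 \<dots> \<tau>\<^sub>k\<close> and the set of all \<open>j \<in> {1..<k}\<close>
  such that \<open>\<tau>\<^sub>j\<close> and \<open>\<tau>\<^bsub>j+1\<^esub>\<close> are separated by a dash. Lists are indexed from 0, so the letter
  \<open>\<tau>\<^sub>j\<close> is \<open>\<tau> ! (j - 1)\<close>; likewise for permutations, which are written as words.
\<close>

type_synonym gpattern = "nat list \<times> nat set"

definition occurrences :: "gpattern \<Rightarrow> nat list \<Rightarrow> nat list set" where
  "occurrences \<tau> \<pi> = (case \<tau> of (w, D) \<Rightarrow>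
     {ix. length ix = length w \<and> set ix \<subseteq> {..<length \<pi>} \<and> sorted_wrt (<) ix \<and>
          (\<forall>a<length w. \<forall>b<length w. \<pi> ! (ix ! a) < \<pi> ! (ix ! b) \<longleftrightarrow> w ! a < w ! b) \<and>
          (\<forall>j\<in>{1..<length w} - D. ix ! j = ix ! (j - 1) + 1)})"

definition avoids :: "nat list \<Rightarrow> gpattern \<Rightarrow> bool" where
  "avoids \<pi> \<tau> \<longleftrightarrow> occurrences \<tau> \<pi> = {}"

definition pattern_1_3_2 :: gpattern where
  "pattern_1_3_2 = ([1, 3, 2], {1, 2})"

text \<open>The pattern \<open>12-3-\<dots>-k\<close>.\<close>

definition pattern_12_3_dots :: "nat \<Rightarrow> gpattern" where
  "pattern_12_3_dots k = ([1..<k + 1], {2..<k})"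

definition h :: "gpattern \<Rightarrow> nat \<Rightarrow> nat" where
  "h \<tau> n = card {\<pi> \<in> permutations_of_set {1..n}.
                   avoids \<pi> \<tau> \<and> card (occurrences pattern_1_3_2 \<pi>) = 1}"

definition H :: "gpattern \<Rightarrow> real fps" where
  "H \<tau> = Abs_fps (\<lambda>n. of_nat (h \<tau> n))"

definition Chebyshev_U :: "nat \<Rightarrow> real poly" where
  "Chebyshev_U p = (THE q. \<forall>\<theta>. sin \<theta> \<noteq> 0 \<longrightarrow> poly q (cos \<theta>) = sin (real (p + 1) * \<theta>) / sin \<theta>)"

lemma finite_occurrences: "finite (occurrences \<tau> \<pi>)"
proof (rule finite_subset)
  show "occurrences \<tau> \<pi> \<subseteq> {ix. set ix \<subseteq> {..<length \<pi>} \<and> length ix = length (fst \<tau>)}"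
    by (auto simp: occurrences_def split: prod.splits)
qed (simp add: finite_lists_length_eq)

lemma Chebyshev_U_exists:
  "\<exists>q :: real poly. \<forall>\<theta>. sin \<theta> \<noteq> 0 \<longrightarrow> poly q (cos \<theta>) = sin (real (p + 1) * \<theta>) / sin \<theta>"
proof (induction p rule: induct_nat_012)
  case 0
  show ?case by (rule exI[of _ 1]) simp
next
  case 1
  show ?case by (rule exI[of _ "[:0, 2:]"]) (simp add: sin_double)
next
  case (ge2 n)
  then obtain q r :: "real poly"
    where q: "\<And>\<theta>. sin \<theta> \<noteq> 0 \<Longrightarrow> poly q (cos \<theta>) = sin (real (n + 1) * \<theta>) / sin \<theta>"
      and r: "\<And>\<theta>. sin \<theta> \<noteq> 0 \<Longrightarrow> poly r (cos \<theta>) = sin (real (Suc n + 1) * \<theta>) / sin \<theta>"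
    by blast
  have rec: "sin (real (Suc (Suc n) + 1) * \<theta>) =
      2 * cos \<theta> * sin (real (Suc n + 1) * \<theta>) - sin (real (n + 1) * \<theta>)" for \<theta>
  proof -
    have "real (Suc (Suc n) + 1) * \<theta> = real (Suc n + 1) * \<theta> + \<theta>"
      and "real (n + 1) * \<theta> = real (Suc n + 1) * \<theta> - \<theta>"
      by (simp_all add: algebra_simps)
    then show ?thesis by (simp only: sin_add sin_diff) simp
  qed
  show ?case
  proof (intro exI[of _ "[:0, 2:] * r - q"] allI impI)
    fix \<theta> :: real
    assume "sin \<theta> \<noteq> 0"
    then show "poly ([:0, 2:] * r - q) (cos \<theta>) = sin (real (Suc (Suc n) + 1) * \<theta>) / sin \<theta>"
      unfolding rec by (simp add: q r diff_divide_distrib del: of_nat_add of_nat_Suc)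
  qed
qed

lemma Chebyshev_U_unique:
  "\<exists>!q :: real poly. \<forall>\<theta>. sin \<theta> \<noteq> 0 \<longrightarrow> poly q (cos \<theta>) = sin (real (p + 1) * \<theta>) / sin \<theta>"
proof (rule ex_ex1I[OF Chebyshev_U_exists])
  fix q r :: "real poly"
  assume q: "\<forall>\<theta>. sin \<theta> \<noteq> 0 \<longrightarrow> poly q (cos \<theta>) = sin (real (p + 1) * \<theta>) / sin \<theta>"
    and r: "\<forall>\<theta>. sin \<theta> \<noteq> 0 \<longrightarrow> poly r (cos \<theta>) = sin (real (p + 1) * \<theta>) / sin \<theta>"
  have "{-1<..<1} \<subseteq> {x. poly (q - r) x = 0}"
  proof
    fix x :: real
    assume x: "x \<in> {-1<..<1}"
    then have "sin (arccos x) \<noteq> 0" by (intro sin_arccos_nonzero) auto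
    with q r have "poly q (cos (arccos x)) = poly r (cos (arccos x))" by simp
    with x show "x \<in> {x. poly (q - r) x = 0}" by (simp add: cos_arccos)
  qed
  then have "infinite {x. poly (q - r) x = 0}"
    by (rule infinite_super) (rule infinite_Ioo, simp)
  then show "q = r" using poly_roots_finite[of "q - r"] by auto
qed

lemma poly_Chebyshev_U_cos:
  "sin \<theta> \<noteq> 0 \<Longrightarrow> poly (Chebyshev_U p) (cos \<theta>) = sin (real (p + 1) * \<theta>) / sin \<theta>"
  using theI'[OF Chebyshev_U_unique[of p]] unfolding Chebyshev_U_def by blast

text \<open>
  \<open>U_at p t\<close> is the Laurent series \<open>U\<^sub>p(1/(2t))\<close>. An identity in \<open>x\<close> and \<open>\<surd>x\<close> is read in the field of
  formal Laurent series in the variable \<open>t = \<surd>x\<close>: \<open>\<surd>x\<close> is \<^term>\<open>fls_X\<close>, \<open>x\<close> is its square, and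
  \<open>F(x)\<close> for a formal power series \<open>F\<close> is \<open>F(t\<^sup>2)\<close>. The substitution \<open>x = t\<^sup>2\<close> is injective on
  formal power series.
\<close>

definition U_at :: "nat \<Rightarrow> real fls \<Rightarrow> real fls" where
  "U_at p t = poly (map_poly fls_const (Chebyshev_U p)) (1 / (2 * t))"

end

theory Submission
  imports Defs "HOL-Library.Sublist"
begin

text \<open>
  Cut a permutation at its maximum, \<open>\<pi> = L n R\<close>. If \<open>\<pi>\<close> avoids \<open>1-3-2\<close>, every letter of \<open>L\<close> exceeds every
  letter of \<open>R\<close>, so \<open>\<pi>\<close> avoids \<open>12-3-\<dots>-k\<close> iff \<open>L\<close> avoids \<open>12-3-\<dots>-(k-1)\<close> and \<open>R\<close> avoids \<open>12-3-\<dots>-k\<close>;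
  this gives \<open>F\<^sub>k = 1 + x F\<^bsub>k-1\<^esub> F\<^sub>k\<close> for the permutations avoiding both patterns. If \<open>\<pi>\<close> has exactly one
  occurrence of \<open>1-3-2\<close>, either \<open>L\<close> still lies above \<open>R\<close> and the occurrence is inside \<open>L\<close> or \<open>R\<close>, or the
  occurrence is \<open>a n b\<close>. In the latter case \<open>a\<close> is the last letter of \<open>L\<close>, the rest of \<open>L\<close> lies above \<open>a\<close>
  and \<open>R\<close>, and \<open>a, b\<close> are the two largest letters of \<open>a R\<close>, so the remaining freedom is a pair of
  \<open>1-3-2\<close>-avoiding words, the second one nonempty. Hence
  \<open>H\<^sub>k = x (H\<^bsub>k-1\<^esub> F\<^sub>k + F\<^bsub>k-1\<^esub> H\<^sub>k) + x\<^sup>2 F\<^bsub>k-1\<^esub> (F\<^sub>k - 1)\<close> for \<open>k \<ge> 3\<close>, with \<open>H\<^sub>2 = 0\<close>. Since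
  \<open>F\<^sub>k = U\<^bsub>k-1\<^esub> / (\<surd>x U\<^sub>k)\<close>, this telescopes to \<open>U\<^sub>k\<^sup>2 H\<^sub>k = U\<^bsub>k-1\<^esub>\<^sup>2 H\<^bsub>k-1\<^esub> + x U\<^bsub>k-2\<^esub>\<^sup>2\<close>.
\<close>

unbundle no vec_syntax

section \<open>Occurrences in terms of values\<close>

text \<open>Values replace positions: in a word with distinct letters they carry the same
  information, and they do not shift when the word is cut. The triple is listed in the order of
  appearance, so the middle component plays the 3.\<close>

definition occ_132 :: "'a::linorder list \<Rightarrow> ('a \<times> 'a \<times> 'a) set" where
  "occ_132 xs = {(a, c, b). a < b \<and> b < c \<and> subseq [a, c, b] xs}"

text \<open>The adjacent letters \<open>a # b\<close> render the missing dash between 1 and 2; all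
  later letters of the pattern may be scattered over \<open>s\<close>.\<close>

definition contains_inc :: "nat \<Rightarrow> 'a::linorder list \<Rightarrow> bool" where
  "contains_inc k xs \<longleftrightarrow> (\<exists>p a b s ys. xs = p @ a # b # s \<and> subseq ys s \<and> length ys + 2 = k \<and>
     sorted_wrt (<) (a # b # ys))"

section \<open>From index lists to subsequences\<close>

lemma subseq_iff_map_nth:
  "subseq ys xs \<longleftrightarrow> (\<exists>ix. sorted_wrt (<) ix \<and> set ix \<subseteq> {..<length xs} \<and> ys = map ((!) xs) ix)"
proof
  assume "subseq ys xs"
  then show "\<exists>ix. sorted_wrt (<) ix \<and> set ix \<subseteq> {..<length xs} \<and> ys = map ((!) xs) ix"
  proof induction
    case (list_emb_Nil ys)
    then show ?case by (intro exI[of _ "[]"]) auto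
  next
    case (list_emb_Cons xs ys y)
    then obtain ix where "sorted_wrt (<) ix" "set ix \<subseteq> {..<length ys}" "xs = map ((!) ys) ix"
      by blast
    then show ?case
      by (intro exI[of _ "map Suc ix"]) (auto simp: sorted_wrt_map)
  next
    case (list_emb_Cons2 x y xs ys)
    then obtain ix where "sorted_wrt (<) ix" "set ix \<subseteq> {..<length ys}" "xs = map ((!) ys) ix"
      by blast
    with list_emb_Cons2 show ?case
      by (intro exI[of _ "0 # map Suc ix"]) (auto simp: sorted_wrt_map)
  qed
next
  assume "\<exists>ix. sorted_wrt (<) ix \<and> set ix \<subseteq> {..<length xs} \<and> ys = map ((!) xs) ix"
  then obtain ix where ix: "sorted_wrt (<) ix" "set ix \<subseteq> {..<length xs}" "ys = map ((!) xs) ix"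
    by blast
  \<comment> \<open>Generalised to the suffixes \<open>drop m xs\<close>, because the indices after
    the first one \<open>i\<close> all lie in the suffix that starts at
    \<open>Suc i\<close>.\<close>
  have "sorted_wrt (<) ix \<Longrightarrow> set ix \<subseteq> {m..<length xs} \<Longrightarrow> m \<le> length xs \<Longrightarrow>
      subseq (map ((!) xs) ix) (drop m xs)" for m
  proof (induction ix arbitrary: m)
    case (Cons i ix)
    have "subseq (map ((!) xs) ix) (drop (Suc i) xs)"
      using Cons.prems by (intro Cons.IH) (auto simp: Suc_le_eq)
    moreover have "drop i xs = xs ! i # drop (Suc i) xs"
      using Cons.prems by (simp add: Cons_nth_drop_Suc)
    ultimately have "subseq (map ((!) xs) (i # ix)) (drop i xs)" by simp
    moreover have "drop m xs = take (i - m) (drop m xs) @ drop i xs"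
      using Cons.prems by (metis append_take_drop_id atLeastLessThan_iff drop_drop le_add_diff_inverse2
        list.set_intros(1) subsetD)
    ultimately show ?case by (metis list_emb_append2)
  qed simp
  from this[of 0] ix show "subseq ys xs" by (simp add: lessThan_atLeast0)
qed

lemma subseq_set_subset: "subseq xs ys \<Longrightarrow> set xs \<subseteq> set ys"
  by (induction rule: list_emb.induct) auto

lemma subseq_pair_append:
  "subseq [a, b] (xs @ ys) \<longleftrightarrow> subseq [a, b] xs \<or> a \<in> set xs \<and> b \<in> set ys \<or> subseq [a, b] ys"
  (is "_ \<longleftrightarrow> ?R")
proof
  assume "subseq [a, b] (xs @ ys)"
  then show ?R
    unfolding subseq_append_iff by (auto simp: Cons_eq_append_conv subseq_singleton_left)
next
  assume ?R
  then show "subseq [a, b] (xs @ ys)"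
    using list_emb_append_mono[of "(=)" "[a]" xs "[b]" ys]
    by (auto simp: subseq_singleton_left intro: subseq_drop_many subseq_rev_drop_many)
qed

lemma subseq_triple_append:
  "subseq [a, b, c] (xs @ ys) \<longleftrightarrow> subseq [a, b, c] xs \<or> subseq [a, b] xs \<and> c \<in> set ys \<or>
     a \<in> set xs \<and> subseq [b, c] ys \<or> subseq [a, b, c] ys"
  (is "_ \<longleftrightarrow> ?R")
proof
  assume "subseq [a, b, c] (xs @ ys)"
  then show ?R
    unfolding subseq_append_iff by (auto simp: Cons_eq_append_conv subseq_singleton_left)
next
  assume ?R
  then show "subseq [a, b, c] (xs @ ys)"
    using list_emb_append_mono[of "(=)" "[a]" xs "[b, c]" ys]
      list_emb_append_mono[of "(=)" "[a, b]" xs "[c]" ys]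
    by (auto simp: subseq_singleton_left intro: subseq_drop_many subseq_rev_drop_many)
qed

lemma avoids_pattern_12_3_dots_iff:
  assumes "k \<ge> 2"
  shows "avoids \<pi> (pattern_12_3_dots k) \<longleftrightarrow> \<not> contains_inc k \<pi>"
proof -
  have "contains_inc k \<pi>" if "ix \<in> occurrences (pattern_12_3_dots k) \<pi>" for ix
  proof -
    from that have len: "length ix = k" and sub: "set ix \<subseteq> {..<length \<pi>}"
      and srt: "sorted_wrt (<) ix" and
      iso: "\<And>a b. a < k \<Longrightarrow> b < k \<Longrightarrow> \<pi> ! (ix ! a) < \<pi> ! (ix ! b) \<longleftrightarrow> a < b"
      and adj: "\<forall>j\<in>{1..<k} - {2..<k}. ix ! j = ix ! (j - 1) + 1"
      by (auto simp: occurrences_def pattern_12_3_dots_def nth_upt simp del: upt_Suc)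
    obtain i i' js where ix: "ix = i # i' # js"
      using len assms by (metis Suc_le_length_iff numeral_2_eq_2)
    \<comment> \<open>The only index without a dash is 1, so adjacency says exactly that the first
      two positions are consecutive.\<close>
    from bspec[OF adj, of 1] assms have i': "i' = Suc i" by (simp add: ix)
    let ?s = "drop (i + 2) \<pi>"
    let ?ys = "map ((!) \<pi>) js"
    have "\<pi> = take i \<pi> @ \<pi> ! i # \<pi> ! i' # ?s"
      using sub by (simp add: ix i' Cons_nth_drop_Suc)
    moreover have "subseq ?ys ?s"
    proof -
      \<comment> \<open>The later positions all lie past the adjacent pair; subtracting
        \<open>m\<close> turns them into positions in the suffix.\<close>
      define m where "m = i + 2"
      have "\<And>j. j \<in> set js \<Longrightarrow> j \<ge> m" "m \<le> length \<pi>" "sorted_wrt (<) js"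
          "\<And>j. j \<in> set js \<Longrightarrow> j < length \<pi>"
        using srt sub by (auto simp: ix i' m_def)
      then have "sorted_wrt (<) (map (\<lambda>j. j - m) js)"
          "set (map (\<lambda>j. j - m) js) \<subseteq> {..<length (drop m \<pi>)}"
          "?ys = map ((!) (drop m \<pi>)) (map (\<lambda>j. j - m) js)"
        by (force simp: sorted_wrt_map intro: sorted_wrt_mono_rel[of js "(<)"],
            force simp: diff_less_mono, simp)
      then show ?thesis unfolding subseq_iff_map_nth m_def by blast
    qed
    moreover have "sorted_wrt (<) (map ((!) \<pi>) ix)"
      by (auto simp: sorted_wrt_iff_nth_less len iso)
    moreover have "length ?ys + 2 = k" using len by (simp add: ix)
    ultimately show ?thesis unfolding contains_inc_def ix list.map by blast
  qed
  moreover have "occurrences (pattern_12_3_dots k) \<pi> \<noteq> {}" if "contains_inc k \<pi>"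
  proof -
    from that obtain p a b s ys where \<pi>: "\<pi> = p @ a # b # s" and ys: "subseq ys s"
      and len: "length ys + 2 = k" and srt: "sorted_wrt (<) (a # b # ys)"
      unfolding contains_inc_def by blast
    from ys obtain js where js: "sorted_wrt (<) js" "set js \<subseteq> {..<length s}" "ys = map ((!) s) js"
      unfolding subseq_iff_map_nth by blast
    let ?n = "length p"
    define ix where "ix = ?n # Suc ?n # map (\<lambda>j. j + (?n + 2)) js"
    have map: "map ((!) \<pi>) ix = a # b # ys"
      by (auto simp: ix_def \<pi> js nth_append)
    have lix: "length ix = k" using len js by (simp add: ix_def)
    have nth: "\<pi> ! (ix ! j) = (a # b # ys) ! j" if "j < k" for j
      using that lix by (metis map nth_map)
    have "(a # b # ys) ! i < (a # b # ys) ! j \<longleftrightarrow> i < j" if "i < k" "j < k" for i j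
    proof -
      have "i < j \<Longrightarrow> j < k \<Longrightarrow> (a # b # ys) ! i < (a # b # ys) ! j" for i j
        using srt len by (subst (asm) sorted_wrt_iff_nth_less) auto
      then show ?thesis using that by (metis linorder_cases order_less_asym order_less_irrefl)
    qed
    then have "\<forall>i<k. \<forall>j<k. \<pi> ! (ix ! i) < \<pi> ! (ix ! j) \<longleftrightarrow> [1..<k + 1] ! i < [1..<k + 1] ! j"
      by (simp add: nth nth_upt del: upt_Suc)
    moreover have "sorted_wrt (<) ix" using js by (simp add: ix_def sorted_wrt_map)
    moreover have "set ix \<subseteq> {..<length \<pi>}" using js by (auto simp: ix_def \<pi>)
    moreover have "ix ! j = ix ! (j - 1) + 1" if "j \<in> {1..<k} - {2..<k}" for j
    proof -
      from that have "j = 1" by auto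
      then show ?thesis by (simp add: ix_def)
    qed
    ultimately have "ix \<in> occurrences (pattern_12_3_dots k) \<pi>"
      using lix unfolding occurrences_def pattern_12_3_dots_def
      by (auto simp del: upt_Suc)
    then show ?thesis by blast
  qed
  ultimately show ?thesis unfolding avoids_def by blast
qed

text \<open>Reading off values is a bijection from occurrences to triples; injectivity is where
  distinctness enters.\<close>

lemma card_occurrences_1_3_2:
  assumes "distinct \<pi>"
  shows "card (occurrences pattern_1_3_2 \<pi>) = card (occ_132 \<pi>)"
proof -
  let ?f = "\<lambda>ix. (\<pi> ! (ix ! 0), \<pi> ! (ix ! 1), \<pi> ! (ix ! 2))"
  have *: "ix \<in> occurrences pattern_1_3_2 \<pi> \<longleftrightarrow> (\<exists>i j l. ix = [i, j, l] \<and> i < j \<and> j < l \<and>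
     l < length \<pi> \<and> \<pi> ! i < \<pi> ! l \<and> \<pi> ! l < \<pi> ! j)" for ix
  proof (cases "length ix = 3")
    case True
    then obtain i j l where "ix = [i, j, l]"
      by (auto simp: numeral_3_eq_3 length_Suc_conv)
    then show ?thesis
      by (auto simp: occurrences_def pattern_1_3_2_def less_Suc_eq numeral_3_eq_3)
  qed (auto simp: occurrences_def pattern_1_3_2_def)
  have "bij_betw ?f (occurrences pattern_1_3_2 \<pi>) (occ_132 \<pi>)"
  proof (rule bij_betw_imageI)
    show "inj_on ?f (occurrences pattern_1_3_2 \<pi>)"
      using assms by (auto simp: inj_on_def * nth_eq_iff_index_eq)
    show "?f ` occurrences pattern_1_3_2 \<pi> = occ_132 \<pi>"
    proof (intro equalityI subsetI)
      fix v assume "v \<in> ?f ` occurrences pattern_1_3_2 \<pi>"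
      then obtain i j l where v: "v = (\<pi> ! i, \<pi> ! j, \<pi> ! l)" and ijl: "i < j" "j < l"
         "l < length \<pi>" "\<pi> ! i < \<pi> ! l" "\<pi> ! l < \<pi> ! j"
        by (auto simp: *)
      then show "v \<in> occ_132 \<pi>"
        by (auto simp: occ_132_def subseq_iff_map_nth intro!: exI[of _ "[i, j, l]"])
    next
      fix v assume "v \<in> occ_132 \<pi>"
      then obtain a c b where v: "v = (a, c, b)" "a < b" "b < c" "subseq [a, c, b] \<pi>"
        by (auto simp: occ_132_def)
      then obtain ix where ix: "sorted_wrt (<) ix" "set ix \<subseteq> {..<length \<pi>}" "map ((!) \<pi>) ix = [a, c, b]"
        unfolding subseq_iff_map_nth by metis
      from ix(3) obtain i j l where "ix = [i, j, l]" by auto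
      with ix v show "v \<in> ?f ` occurrences pattern_1_3_2 \<pi>"
        by (intro image_eqI[of _ _ ix]) (auto simp: *)
    qed
  qed
  then show ?thesis by (rule bij_betw_same_card)
qed

section \<open>Occurrences of both patterns in a word cut at its largest letter\<close>

lemma finite_occ_132 [simp]: "finite (occ_132 xs)"
proof (rule finite_subset)
  show "occ_132 xs \<subseteq> set xs \<times> set xs \<times> set xs"
    by (auto simp: occ_132_def dest!: subseq_set_subset)
qed simp

lemma occ_132_set: "(a, c, b) \<in> occ_132 xs \<Longrightarrow> a \<in> set xs \<and> b \<in> set xs \<and> c \<in> set xs"
  by (auto simp: occ_132_def dest!: subseq_set_subset)

text \<open>Occurrences are sorted by where the cut falls among their three letters. The maximum
  \<open>M\<close> can only play the 3.\<close>

lemma occ_132_append_Cons_max: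
  assumes "\<forall>x\<in>set L \<union> set R. x < M"
  shows "occ_132 (L @ M # R) = occ_132 L \<union> occ_132 R \<union>
    {(a, c, b). c = M \<and> a \<in> set L \<and> b \<in> set R \<and> a < b} \<union>
    {(a, c, b). a < b \<and> b < c \<and> subseq [a, c] L \<and> b \<in> set R} \<union>
    {(a, c, b). a < b \<and> b < c \<and> a \<in> set L \<and> subseq [c, b] R}"
proof -
  have pair: "x \<in> set xs \<and> y \<in> set xs" if "subseq [x, y] xs" for x y and xs :: "'a list"
    using subseq_set_subset[OF that] by simp
  have R2: "subseq [x, y] (M # R) \<longleftrightarrow> x = M \<and> y \<in> set R \<or> subseq [x, y] R" for x y
    using subseq_pair_append[of x y "[M]" R] by simp
  have R3: "subseq [x, y, z] (M # R) \<longleftrightarrow> x = M \<and> subseq [y, z] R \<or> subseq [x, y, z] R" for x y z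
    using subseq_triple_append[of x y z "[M]" R] by simp
  have "a < b \<and> b < c \<and> subseq [a, c, b] (L @ M # R) \<longleftrightarrow> a < b \<and> b < c \<and>
     (subseq [a, c, b] L \<or> subseq [a, c, b] R \<or> c = M \<and> a \<in> set L \<and> b \<in> set R \<or>
      subseq [a, c] L \<and> b \<in> set R \<or> a \<in> set L \<and> subseq [c, b] R)" for a b c
  proof -
    \<comment> \<open>These are the cases in which \<open>M\<close> would play the 2 or the 1; both
      require a letter above \<open>M\<close>.\<close>
    have "\<not> (b = M \<and> b < c \<and> subseq [a, c] L)" "\<not> (a = M \<and> a < b \<and> subseq [c, b] R)"
      using assms pair[of a c L] pair[of c b R] by (meson UnI1 UnI2 less_asym)+
    then show ?thesis
      unfolding subseq_triple_append[of a c b L "M # R"] R2 R3 by (simp only: list.set insert_iff) blast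
  qed
  then show ?thesis
    using assms unfolding occ_132_def by (auto simp del: subseq_Cons2_iff)
qed

text \<open>An occurrence that straddles the cut has its 1 in \<open>L\<close> and its 2 in
  \<open>R\<close>, which is impossible if \<open>L\<close> lies above \<open>R\<close>.\<close>

lemma occ_132_append_Cons_separated:
  assumes "\<forall>x\<in>set L \<union> set R. x < M" "\<forall>l\<in>set L. \<forall>r\<in>set R. r < l"
  shows "occ_132 (L @ M # R) = occ_132 L \<union> occ_132 R"
proof -
  have "\<not> a < b" if "subseq [a, c] L" "b \<in> set R" for a b c
    using that assms(2) subseq_set_subset[OF that(1)] by fastforce
  moreover have "\<not> a < b" if "a \<in> set L" "subseq [c, b] R" for a b c
    using that assms(2) subseq_set_subset[OF that(2)] by fastforce
  moreover have "\<not> a < b" if "a \<in> set L" "b \<in> set R" for a b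
    using that assms(2) by fastforce
  ultimately show ?thesis unfolding occ_132_append_Cons_max[OF assms(1)] by blast
qed

lemma card_occ_132_separated:
  assumes "\<forall>x\<in>set L \<union> set R. x < M" "\<forall>l\<in>set L. \<forall>r\<in>set R. r < l"
  shows "card (occ_132 (L @ M # R)) = card (occ_132 L) + card (occ_132 R)"
proof -
  have "occ_132 L \<inter> occ_132 R = {}"
    using assms(2) by (fastforce dest: occ_132_set)
  then show ?thesis
    unfolding occ_132_append_Cons_separated[OF assms] by (simp add: card_Un_disjoint)
qed

lemma occ_132_snoc_min:
  assumes "\<forall>x\<in>set L. a < x"
  shows "occ_132 (L @ [a]) = occ_132 L"
proof -
  have "\<not> x < a" if "subseq [x, y] L" for x y
    using that assms subseq_set_subset[OF that] by fastforce
  then show ?thesis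
    by (auto simp: occ_132_def subseq_triple_append)
qed

text \<open>A straddling occurrence needs a letter left of \<open>M\<close> below one on the right,
  and the only such pair is \<open>a\<close>, \<open>b\<close>. The 3 must be \<open>M\<close>:
  every letter of \<open>L\<close> precedes \<open>a\<close>, and \<open>b\<close> is the largest
  letter of \<open>R\<close>.\<close>

lemma occ_132_crossing:
  assumes "\<forall>x\<in>set L \<union> set R. x < M" "a < b" "b \<in> set R"
    "\<forall>l\<in>set L. a < l \<and> (\<forall>r\<in>set R. r < l)" "\<forall>r\<in>set R - {b}. r < a"
    "occ_132 L = {}" "occ_132 R = {}"
  shows "occ_132 (L @ a # M # R) = {(a, M, b)}"
proof -
  have "\<forall>x\<in>set (L @ [a]) \<union> set R. x < M" using assms by (auto intro: less_trans)
  note eq = occ_132_append_Cons_max[OF this]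
  have 1: "\<not> (x < z \<and> z < y)" if "subseq [x, y] (L @ [a])" "z \<in> set R" for x y z
  proof -
    from that(1) have "subseq [x, y] L \<or> x \<in> set L"
      by (auto simp: subseq_pair_append split: if_splits)
    then have "x \<in> set L" by (auto dest: subseq_set_subset)
    with assms that show ?thesis by fastforce
  qed
  have 2: "\<not> (x < z \<and> z < y)" if "x \<in> set (L @ [a])" "subseq [y, z] R" for x y z
  proof
    assume *: "x < z \<and> z < y"
    from that(2) have yz: "y \<in> set R" "z \<in> set R" by (auto dest: subseq_set_subset)
    with * that assms(4) have "x = a" by fastforce
    with * yz assms(5) have "z = b" by (metis Diff_iff empty_iff insert_iff less_asym)
    with * yz assms(2,5) show False
      by (metis Diff_iff empty_iff insert_iff less_asym less_trans)
  qed
  have 3: "x \<in> set (L @ [a]) \<and> y \<in> set R \<and> x < y \<longleftrightarrow> x = a \<and> y = b" for x y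
  proof
    assume *: "x \<in> set (L @ [a]) \<and> y \<in> set R \<and> x < y"
    with assms(4) have "x = a" by fastforce
    with * assms(5) show "x = a \<and> y = b" by (metis Diff_iff empty_iff insert_iff less_asym)
  qed (use assms(2,3) in simp)
  have "occ_132 (L @ [a]) = {}" using occ_132_snoc_min[of L a] assms(4,6) by simp
  moreover have "{(x, c, y). c = M \<and> x \<in> set (L @ [a]) \<and> y \<in> set R \<and> x < y} = {(a, M, b)}"
    using 3 by blast
  moreover have "{(x, c, y). x < y \<and> y < c \<and> subseq [x, c] (L @ [a]) \<and> y \<in> set R} = {}"
    using 1 by blast
  moreover have "{(x, c, y). x < y \<and> y < c \<and> x \<in> set (L @ [a]) \<and> subseq [c, y] R} = {}"
    using 2 by blast
  ultimately have "occ_132 ((L @ [a]) @ M # R) = {(a, M, b)}"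
    unfolding eq assms(7) by (simp only: Un_empty_left Un_empty_right)
  then show ?thesis by simp
qed

text \<open>An occurrence that starts in \<open>L\<close> can leave \<open>L\<close> only through
  \<open>M\<close>, which costs one letter of the pattern. The hypothesis \<open>asc\<close> speaks
  only of the tops of ascents, not of all letters of \<open>L\<close>, so that it also covers the
  crossing case, where the last letter of \<open>L\<close> lies below a letter of
  \<open>R\<close>.\<close>

lemma contains_inc_append_Cons_max:
  assumes k: "k \<ge> 2" and M: "\<forall>x\<in>set L \<union> set R. x < M"
    and asc: "\<And>p x y s r. L = p @ x # y # s \<Longrightarrow> x < y \<Longrightarrow> r \<in> set R \<Longrightarrow> r < y"
  shows "contains_inc (Suc k) (L @ M # R) \<longleftrightarrow> contains_inc k L \<or> contains_inc (Suc k) R"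
proof
  assume "contains_inc k L \<or> contains_inc (Suc k) R"
  then show "contains_inc (Suc k) (L @ M # R)"
  proof
    assume "contains_inc k L"
    then obtain p a b s ys where *: "L = p @ a # b # s" "subseq ys s" "length ys + 2 = k"
      "sorted_wrt (<) (a # b # ys)"
      unfolding contains_inc_def by blast
    have "subseq (ys @ [M]) (s @ M # R)"
      using *(2) by (intro list_emb_append_mono) auto
    moreover have "sorted_wrt (<) (a # b # ys @ [M])"
      using * M by (auto simp: sorted_wrt_append dest: subseq_set_subset)
    ultimately show ?thesis using * unfolding contains_inc_def
      by (intro exI[of _ p] exI[of _ a] exI[of _ b] exI[of _ "s @ M # R"] exI[of _ "ys @ [M]"]) simp
  next
    assume "contains_inc (Suc k) R"
    then obtain p a b s ys where *: "R = p @ a # b # s" "subseq ys s" "length ys + 2 = Suc k"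
      "sorted_wrt (<) (a # b # ys)"
      unfolding contains_inc_def by blast
    then show ?thesis unfolding contains_inc_def
      by (intro exI[of _ "L @ M # p"] exI[of _ a] exI[of _ b] exI[of _ s] exI[of _ ys]) simp
  qed
next
  assume "contains_inc (Suc k) (L @ M # R)"
  then obtain p a b s ys where eq: "L @ M # R = p @ a # b # s" and ys: "subseq ys s"
    and len: "length ys + 2 = Suc k" and srt: "sorted_wrt (<) (a # b # ys)"
    unfolding contains_inc_def by blast
  have ys_set: "set ys \<subseteq> set s" using ys by (rule subseq_set_subset)
  have "ys \<noteq> []" using len k by auto
  from eq consider (left) u where "L = p @ a # b # u" "s = u @ M # R"
    | (mid) "b = M" "s = R" | (top) "a = M" "R = b # s"
    | (right) u where "R = u @ a # b # s" "p = L @ M # u"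
    by (auto simp: append_eq_append_conv2 append_eq_Cons_conv Cons_eq_append_conv)
  then show "contains_inc k L \<or> contains_inc (Suc k) R"
  proof cases
    \<comment> \<open>The pattern letters after \<open>L\<close> form \<open>y2\<close>. They exceed
      \<open>b\<close>, the top of an ascent in \<open>L\<close>, so none comes from
      \<open>R\<close> and at most \<open>M\<close> remains.\<close>
    case left
    from ys left obtain y1 y2 where y: "ys = y1 @ y2" "subseq y1 u" "subseq y2 (M # R)"
      by (auto simp: subseq_append_iff)
    have "y2 = [] \<or> y2 = [M]"
    proof -
      have "y \<notin> set R" if "y \<in> set y2" for y
      proof
        assume "y \<in> set R"
        with asc[OF left(1)] srt have "y < b" by simp
        moreover have "b < y" using srt that by (simp add: y)
        ultimately show False by simp
      qed
      then have disj: "set y2 \<inter> set R = {}" by blast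
      show ?thesis
      proof (cases y2)
        case (Cons z zs)
        with y(3) disj have "z = M" "subseq zs R"
          by (auto split: if_splits dest: subseq_set_subset)
        then have "set zs \<subseteq> set R" by (intro subseq_set_subset)
        then have "set zs = set zs \<inter> set R" by (simp add: inf.absorb1)
        also have "\<dots> = {}" using disj Cons by auto
        finally have "set zs = {}" .
        with Cons \<open>z = M\<close> show ?thesis by simp
      qed simp
    qed
    then have "k \<le> length y1 + 2" using len y by auto
    then have "length (take (k - 2) y1) + 2 = k" using k by auto
    moreover have "subseq (take (k - 2) y1) u"
      using y(2) by (metis list_emb_appendD append_take_drop_id prefix_imp_subseq subseq_order.trans take_is_prefix)
    moreover have "sorted_wrt (<) (a # b # take (k - 2) y1)"
      using srt y by (auto simp: sorted_wrt_append sorted_wrt_take dest: in_set_takeD)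
    ultimately show ?thesis using left unfolding contains_inc_def by blast
  next
    \<comment> \<open>Here the adjacent pair ends in \<open>M\<close>. Since the pattern has at
      least three letters, a letter larger than \<open>M\<close> would have to follow.\<close>
    case mid
    obtain y where "y \<in> set ys" using \<open>ys \<noteq> []\<close> by (cases ys) auto
    moreover from this have "M < y" using srt mid by simp
    ultimately show ?thesis using ys_set M mid(2) by (auto dest: less_asym)
  next
    case top
    with srt M have "M < b" "b < M" by simp_all
    then show ?thesis by simp
  next
    case right
    with ys len srt show ?thesis unfolding contains_inc_def by blast
  qed
qed

text \<open>A last letter below everything before it cannot end an increasing subsequence of length
  at least two.\<close>

lemma contains_inc_snoc_min:
  assumes "\<forall>x\<in>set L. a < x"
  shows "contains_inc k (L @ [a]) \<longleftrightarrow> contains_inc k L"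
proof
  assume "contains_inc k (L @ [a])"
  then obtain p x y s ys where eq: "L @ [a] = p @ x # y # s" and ys: "subseq ys s"
    and len: "length ys + 2 = k" and srt: "sorted_wrt (<) (x # y # ys)"
    unfolding contains_inc_def by blast
  show "contains_inc k L"
  proof (cases s rule: rev_cases)
    case Nil
    then have "L = p @ [x]" "y = a" using eq by (simp_all add: append_eq_append_conv2 append_eq_Cons_conv Cons_eq_append_conv)
    with assms srt show ?thesis by fastforce
  next
    case (snoc u z)
    with eq have L: "L = p @ x # y # u" "z = a"
      by (metis append_assoc append_Cons butlast_snoc, metis append_assoc append_Cons last_snoc)
    from ys snoc obtain y1 y2 where y: "ys = y1 @ y2" "subseq y1 u" "subseq y2 [a]"
      using L by (auto simp: subseq_append_iff)
    have "a \<notin> set ys" using srt assms L by fastforce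
    with y have "y2 = []" by (cases y2) (auto split: if_splits)
    with y len srt L show ?thesis unfolding contains_inc_def by fastforce
  qed
next
  assume "contains_inc k L"
  then obtain p x y s ys where *: "L = p @ x # y # s" "subseq ys s" "length ys + 2 = k"
      "sorted_wrt (<) (x # y # ys)"
    unfolding contains_inc_def by blast
  then show "contains_inc k (L @ [a])"
    unfolding contains_inc_def
    by (intro exI[of _ p] exI[of _ x] exI[of _ y] exI[of _ "s @ [a]"] exI[of _ ys])
       (auto intro: subseq_rev_drop_many)
qed

section \<open>Generating functions\<close>

text \<open>The junk value \<open>F\<^sub>0 = 0\<close> makes the recursion start with \<open>F\<^sub>1 = 1\<close>.\<close>

primrec avoid_fps :: "nat \<Rightarrow> real fps" where
  "avoid_fps 0 = 0"
| "avoid_fps (Suc k) = inverse (1 - fps_X * avoid_fps k)"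

text \<open>The recursion
  \<open>H_k = x (H_(k-1) F_k + F_(k-1) H_k) + x^2 F_(k-1) (F_k - 1)\<close>, solved for
  \<open>H_k\<close> by means of \<open>1 / (1 - x F_(k-1)) = F_k\<close> and
  \<open>F_k - 1 = x F_(k-1) F_k\<close>, so that the right side refers only to smaller indices of
  this series.\<close>

fun one_fps :: "nat \<Rightarrow> real fps" where
  "one_fps k = (if k \<le> 2 then 0 else
     fps_X * (avoid_fps k)\<^sup>2 * (one_fps (k - 1) + fps_X\<^sup>2 * (avoid_fps (k - 1))\<^sup>2))"

declare avoid_fps.simps(2) [simp del] one_fps.simps [simp del]

lemma avoid_fps_eq:
  "avoid_fps (Suc k) = 1 + fps_X * (avoid_fps k * avoid_fps (Suc k))"
proof -
  have "(1 - fps_X * avoid_fps k) * avoid_fps (Suc k) = 1"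
    by (simp add: avoid_fps.simps inverse_mult_eq_1')
  then show ?thesis by (simp add: algebra_simps)
qed

lemma avoid_fps_2_nth: "avoid_fps 2 $ n = 1"
proof -
  have "avoid_fps 2 = Abs_fps (\<lambda>_. 1)"
    using fps_inverse_idempotent[of "Abs_fps (\<lambda>_. 1 :: real)"]
    by (simp add: numeral_2_eq_2 avoid_fps.simps fps_inverse_gp')
  then show ?thesis by simp
qed

text \<open>Back to the unsolved form, whose three summands match the three kinds of words:
  occurrence to the left of the maximum, to the right of it, or through it.\<close>

lemma one_fps_eq:
  assumes "k \<ge> 2"
  shows "one_fps (Suc k) = fps_X * (one_fps k * avoid_fps (Suc k) + avoid_fps k * one_fps (Suc k) +
           avoid_fps k * (fps_X * (avoid_fps (Suc k) - 1)))"
proof -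
  let ?F = "avoid_fps (Suc k)" and ?E = "avoid_fps k" and ?G = "one_fps k"
  have 1: "(1 - fps_X * ?E) * ?F = 1"
    by (simp add: avoid_fps.simps inverse_mult_eq_1')
  have H: "one_fps (Suc k) = fps_X * ?F\<^sup>2 * (?G + fps_X\<^sup>2 * ?E\<^sup>2)"
    using assms by (subst one_fps.simps) simp
  have "(1 - fps_X * ?E) * one_fps (Suc k) = ((1 - fps_X * ?E) * ?F) * fps_X * ?F * (?G + fps_X\<^sup>2 * ?E\<^sup>2)"
    unfolding H by (simp add: power2_eq_square mult_ac)
  also have "\<dots> = fps_X * (?G * ?F + ?E * (fps_X * (fps_X * (?E * ?F))))"
    unfolding 1 by (simp add: algebra_simps power2_eq_square)
  also have "fps_X * (?E * ?F) = ?F - 1"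
    using avoid_fps_eq[of k] by (simp add: algebra_simps)
  finally show ?thesis by (simp add: algebra_simps)
qed

section \<open>Decomposition at the maximum\<close>

text \<open>The letters come from an arbitrary linearly ordered set, because the two sides of the
  maximum use subsets that are not initial intervals. Only the number of letters affects the
  count.\<close>

definition avoid_set :: "nat \<Rightarrow> 'a::linorder set \<Rightarrow> 'a list set" where
  "avoid_set k S = {xs \<in> permutations_of_set S. card (occ_132 xs) = 0 \<and> \<not> contains_inc k xs}"

definition one_set :: "nat \<Rightarrow> 'a::linorder set \<Rightarrow> 'a list set" where
  "one_set k S = {xs \<in> permutations_of_set S. card (occ_132 xs) = 1 \<and> \<not> contains_inc k xs}"

text \<open>
  A word \<open>L a n R\<close> whose only occurrence of \<open>1-3-2\<close> is \<open>a n b\<close> is encoded by the pair of \<open>L\<close> and \<open>a R\<close>,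
  which is again separated by value; \<open>cross_set\<close> describes the second component.
\<close>

definition cross_set :: "nat \<Rightarrow> 'a::linorder set \<Rightarrow> 'a list set" where
  "cross_set k E = {a # R |a R. a \<notin> set R \<and> insert a (set R) = E \<and> R \<in> avoid_set k (set R) \<and>
     (\<exists>b\<in>set R. a < b \<and> (\<forall>r\<in>set R - {b}. r < a))}"

text \<open>The combinatorial product behind the product of generating functions: the separation by
  value leaves only the sizes of the two letter sets to choose.\<close>

definition split_pairs ::
  "('a::linorder set \<Rightarrow> 'a list set) \<Rightarrow> ('a set \<Rightarrow> 'a list set) \<Rightarrow> 'a set \<Rightarrow> ('a list \<times> 'a list) set"
where
  "split_pairs X Y T = {(L, R). L \<in> X (set L) \<and> R \<in> Y (set R) \<and> set L \<union> set R = T \<and>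
     (\<forall>l\<in>set L. \<forall>r\<in>set R. r < l)}"

lemma avoid_set_subset: "avoid_set k S \<subseteq> permutations_of_set S"
  and one_set_subset: "one_set k S \<subseteq> permutations_of_set S"
  and cross_set_subset: "cross_set k S \<subseteq> permutations_of_set S"
  by (auto simp: avoid_set_def one_set_def cross_set_def permutations_of_set_def)

text \<open>A separated pair is fixed in its letters by \<open>i\<close>, the size of
  \<open>set R\<close>: the \<open>i\<close> smallest letters go right, the others left.\<close>

lemma split_pairs_eq_UN:
  fixes T :: "'a::linorder set"
  assumes "finite T" "\<And>U. X U \<subseteq> permutations_of_set U" "\<And>U. Y U \<subseteq> permutations_of_set U"
  defines "s \<equiv> sorted_list_of_set T"
  shows "split_pairs X Y T = (\<Union>i\<in>{0..card T}. X (set (drop i s)) \<times> Y (set (take i s)))"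
proof (intro equalityI subsetI)
  fix v assume "v \<in> split_pairs X Y T"
  then obtain L R where v: "v = (L, R)" and LR: "L \<in> X (set L)" "R \<in> Y (set R)"
    "set L \<union> set R = T" "\<forall>l\<in>set L. \<forall>r\<in>set R. r < l"
    by (auto simp: split_pairs_def)
  let ?i = "card (set R)" and ?sl = "sorted_list_of_set (set L)" and ?sr = "sorted_list_of_set (set R)"
  have "sorted_wrt (<) (?sr @ ?sl)"
    using LR(4) by (auto simp: sorted_wrt_append)
  moreover have "set (?sr @ ?sl) = set s"
    using LR(3) assms(1) by (auto simp: s_def)
  ultimately have "s = ?sr @ ?sl"
    unfolding s_def by (intro strict_sorted_equal) simp_all
  then have "set (take ?i s) = set R" "set (drop ?i s) = set L" by simp_all
  moreover have "?i \<le> card T" using LR(3) assms(1) by (auto intro: card_mono)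
  ultimately show "v \<in> (\<Union>i\<in>{0..card T}. X (set (drop i s)) \<times> Y (set (take i s)))"
    using LR v by (intro UN_I[of ?i]) auto
next
  fix v assume "v \<in> (\<Union>i\<in>{0..card T}. X (set (drop i s)) \<times> Y (set (take i s)))"
  then obtain i L R where v: "v = (L, R)" and LR: "L \<in> X (set (drop i s))" "R \<in> Y (set (take i s))"
    by auto
  have "L \<in> permutations_of_set (set (drop i s))" "R \<in> permutations_of_set (set (take i s))"
    using LR assms(2,3) by blast+
  then have sets: "set L = set (drop i s)" "set R = set (take i s)"
    by (auto dest: permutations_of_setD)
  have "sorted_wrt (<) (take i s @ drop i s)" by (simp add: s_def)
  then have "\<forall>l\<in>set L. \<forall>r\<in>set R. r < l"
    unfolding sets sorted_wrt_append by blast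
  moreover have "set L \<union> set R = T"
    unfolding sets by (metis assms(1) append_take_drop_id s_def set_append set_sorted_list_of_set sup_commute)
  ultimately show "v \<in> split_pairs X Y T"
    using LR v by (auto simp: split_pairs_def sets)
qed

text \<open>Summing over the cut point gives the Cauchy product. The counts are required only for
  subsets of \<open>T\<close>, which suits inductions on the size of the letter set.\<close>

lemma card_split_pairs:
  fixes T :: "'a::linorder set" and x y :: "real fps"
  assumes "finite T" "\<And>U. X U \<subseteq> permutations_of_set U" "\<And>U. Y U \<subseteq> permutations_of_set U"
    and X: "\<And>U. U \<subseteq> T \<Longrightarrow> real (card (X U)) = x $ card U"
    and Y: "\<And>U. U \<subseteq> T \<Longrightarrow> real (card (Y U)) = y $ card U"
  shows "real (card (split_pairs X Y T)) = (x * y) $ card T"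
proof -
  define s where "s = sorted_list_of_set T"
  let ?P = "\<lambda>i. X (set (drop i s)) \<times> Y (set (take i s))"
  have s: "distinct s" "set s = T" "length s = card T"
    using assms(1) by (simp_all add: s_def)
  have fin: "finite (?P i)" for i
    using assms(2,3) by (intro finite_cartesian_product) (meson finite_subset finite_permutations_of_set)+
  have disj: "?P i \<inter> ?P j = {}" if "i \<in> {0..card T}" "j \<in> {0..card T}" "i \<noteq> j" for i j
  proof -
    have "card (set (take i s)) = i" "card (set (take j s)) = j"
      using that s by (simp_all add: distinct_card)
    with that have "set (take i s) \<noteq> set (take j s)" by metis
    moreover have "set ys = U" if "ys \<in> Y U" for ys U
      using subsetD[OF assms(3) that] by (rule permutations_of_setD(1))
    ultimately have "Y (set (take i s)) \<inter> Y (set (take j s)) = {}"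
      by (metis disjoint_iff)
    then show ?thesis by blast
  qed
  have "card (split_pairs X Y T) = (\<Sum>i=0..card T. card (?P i))"
    unfolding split_pairs_eq_UN[OF assms(1-3)] s_def[symmetric]
    using fin disj by (intro card_UN_disjoint) auto
  also have "real \<dots> = (\<Sum>i=0..card T. y $ i * x $ (card T - i))"
    unfolding of_nat_sum
  proof (rule sum.cong[OF refl])
    fix i assume i: "i \<in> {0..card T}"
    have "card (set (take i s)) = i" "card (set (drop i s)) = card T - i"
      using i s by (simp_all add: distinct_card)
    moreover have "set (take i s) \<subseteq> T" "set (drop i s) \<subseteq> T"
      using s(2) set_take_subset set_drop_subset by metis+
    ultimately show "real (card (?P i)) = y $ i * x $ (card T - i)"
      using X Y by (simp add: card_cartesian_product)
  qed
  also have "\<dots> = (x * y) $ card T"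
    by (simp add: fps_mult_nth mult.commute[of x y])
  finally show ?thesis .
qed

section \<open>Bijections obtained by removing the maximum\<close>

lemma append_Cons_max_in_permutations_of_set:
  assumes "finite S" "S \<noteq> {}"
  shows "L @ Max S # R \<in> permutations_of_set S \<longleftrightarrow>
    distinct L \<and> distinct R \<and> set L \<inter> set R = {} \<and> set L \<union> set R = S - {Max S}"
  using Max_in[OF assms] by (auto simp: permutations_of_set_def)

lemma permutations_of_set_split_max:
  assumes "finite S" "S \<noteq> {}" "xs \<in> permutations_of_set S"
  obtains L R where "xs = L @ Max S # R" "distinct L" "distinct R" "set L \<inter> set R = {}"
    "set L \<union> set R = S - {Max S}"
proof -
  have "Max S \<in> set xs" using Max_in[OF assms(1,2)] permutations_of_setD(1)[OF assms(3)] by simp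
  then obtain L R where "xs = L @ Max S # R" by (meson split_list)
  with that assms append_Cons_max_in_permutations_of_set[OF assms(1,2)] show ?thesis by blast
qed

lemma less_Max_Diff:
  assumes "finite S" "A = S - {Max S}"
  shows "\<forall>x\<in>A. x < Max S"
  using assms by (auto simp: less_le)

context
  fixes S :: "'a::linorder set" and k :: nat
  assumes S: "finite S" "S \<noteq> {}" and k: "k \<ge> 2"
begin

lemma separated_iff:
  assumes T: "set L \<union> set R = S - {Max S}" and sep: "\<forall>l\<in>set L. \<forall>r\<in>set R. r < l"
  shows "L @ Max S # R \<in> avoid_set (Suc k) S \<longleftrightarrow> L \<in> avoid_set k (set L) \<and> R \<in> avoid_set (Suc k) (set R)"
    and "L @ Max S # R \<in> one_set (Suc k) S \<longleftrightarrow>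
      L \<in> one_set k (set L) \<and> R \<in> avoid_set (Suc k) (set R) \<or>
      L \<in> avoid_set k (set L) \<and> R \<in> one_set (Suc k) (set R)"
proof -
  have M: "\<forall>x\<in>set L \<union> set R. x < Max S"
    using less_Max_Diff[OF S(1) T] .
  have "set L \<inter> set R = {}" using sep by fastforce
  then have perm: "L @ Max S # R \<in> permutations_of_set S \<longleftrightarrow>
      L \<in> permutations_of_set (set L) \<and> R \<in> permutations_of_set (set R)"
    unfolding append_Cons_max_in_permutations_of_set[OF S]
    using T by (simp add: permutations_of_set_def)
  have cont: "contains_inc (Suc k) (L @ Max S # R) \<longleftrightarrow> contains_inc k L \<or> contains_inc (Suc k) R"
    using sep by (intro contains_inc_append_Cons_max k M) auto
  note card = card_occ_132_separated[OF M sep]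
  show "L @ Max S # R \<in> avoid_set (Suc k) S \<longleftrightarrow> L \<in> avoid_set k (set L) \<and> R \<in> avoid_set (Suc k) (set R)"
    unfolding avoid_set_def mem_Collect_eq perm cont card by auto
  show "L @ Max S # R \<in> one_set (Suc k) S \<longleftrightarrow>
      L \<in> one_set k (set L) \<and> R \<in> avoid_set (Suc k) (set R) \<or>
      L \<in> avoid_set k (set L) \<and> R \<in> one_set (Suc k) (set R)"
    unfolding avoid_set_def one_set_def mem_Collect_eq perm cont card by (auto simp: add_is_1)
qed

text \<open>Letters \<open>l < r\<close> on the two sides of the maximum would form an occurrence
  with it.\<close>

lemma separated_if_no_occ:
  assumes T: "set L \<union> set R = S - {Max S}" "set L \<inter> set R = {}"
    and "occ_132 (L @ Max S # R) = {}"
  shows "\<forall>l\<in>set L. \<forall>r\<in>set R. r < l"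
proof (intro ballI)
  fix l r assume lr: "l \<in> set L" "r \<in> set R"
  have "(l, Max S, r) \<notin> occ_132 (L @ Max S # R)" using assms by simp
  with lr have "\<not> l < r"
    unfolding occ_132_append_Cons_max[OF less_Max_Diff[OF S(1) T(1)]] by simp
  moreover have "l \<noteq> r" using lr T(2) by auto
  ultimately show "r < l" by simp
qed

lemma avoid_set_Suc:
  "avoid_set (Suc k) S =
     (\<lambda>(L, R). L @ Max S # R) ` split_pairs (avoid_set k) (avoid_set (Suc k)) (S - {Max S})"
proof (intro equalityI subsetI)
  fix xs assume xs: "xs \<in> avoid_set (Suc k) S"
  then have "xs \<in> permutations_of_set S" using avoid_set_subset by blast
  then obtain L R where LR: "xs = L @ Max S # R" "set L \<inter> set R = {}" "set L \<union> set R = S - {Max S}"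
    using permutations_of_set_split_max[OF S] by metis
  from xs have "occ_132 xs = {}" by (simp add: avoid_set_def)
  then have sep: "\<forall>l\<in>set L. \<forall>r\<in>set R. r < l"
    using LR by (intro separated_if_no_occ) auto
  then have "(L, R) \<in> split_pairs (avoid_set k) (avoid_set (Suc k)) (S - {Max S})"
    using xs LR separated_iff(1)[OF LR(3) sep] by (simp add: split_pairs_def)
  then show "xs \<in> (\<lambda>(L, R). L @ Max S # R) ` split_pairs (avoid_set k) (avoid_set (Suc k)) (S - {Max S})"
    using LR(1) by (intro image_eqI[of _ _ "(L, R)"]) auto
next
  fix xs
  assume "xs \<in> (\<lambda>(L, R). L @ Max S # R) ` split_pairs (avoid_set k) (avoid_set (Suc k)) (S - {Max S})"
  then show "xs \<in> avoid_set (Suc k) S"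
    using separated_iff(1) by (auto simp: split_pairs_def)
qed

lemma crossing_in_one_set:
  assumes T: "set L \<union> insert a (set R) = S - {Max S}" and a: "a \<notin> set R"
    and L: "L \<in> avoid_set k (set L)" and R: "R \<in> avoid_set (Suc k) (set R)"
    and sep: "\<forall>l\<in>set L. a < l \<and> (\<forall>r\<in>set R. r < l)"
    and b: "b \<in> set R" "a < b" "\<forall>r\<in>set R - {b}. r < a"
  shows "L @ a # Max S # R \<in> one_set (Suc k) S"
proof -
  have T': "set (L @ [a]) \<union> set R = S - {Max S}" using T by auto
  have M: "\<forall>x\<in>set (L @ [a]) \<union> set R. x < Max S"
    using less_Max_Diff[OF S(1) T'] .
  have disj: "set (L @ [a]) \<inter> set R = {}" "a \<notin> set L"
    using sep a by fastforce+
  have "(L @ [a]) @ Max S # R \<in> permutations_of_set S"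
    unfolding append_Cons_max_in_permutations_of_set[OF S]
    using T' disj L R by (auto simp: avoid_set_def permutations_of_set_def)
  moreover have "occ_132 (L @ a # Max S # R) = {(a, Max S, b)}"
    using M L R sep b by (intro occ_132_crossing) (auto simp: avoid_set_def)
  moreover have "contains_inc (Suc k) ((L @ [a]) @ Max S # R) \<longleftrightarrow>
      contains_inc k (L @ [a]) \<or> contains_inc (Suc k) R"
  \<comment> \<open>The letter \<open>a\<close> is the smallest of \<open>L @ [a]\<close>, so the
    top of an ascent is never \<open>a\<close> and hence exceeds all of \<open>R\<close>.\<close>
  proof (intro contains_inc_append_Cons_max k M)
    fix p x y s r assume *: "L @ [a] = p @ x # y # s" "x < y" "r \<in> set R"
    have "x \<in> set (L @ [a])" "y \<in> set (L @ [a])" unfolding * by simp_all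
    with *(2) sep have "y \<in> set L" by auto
    with sep *(3) show "r < y" by blast
  qed
  moreover have "contains_inc k (L @ [a]) \<longleftrightarrow> contains_inc k L"
    using sep by (intro contains_inc_snoc_min) auto
  ultimately show ?thesis using L R by (simp add: one_set_def avoid_set_def)
qed

text \<open>The pair \<open>a < b\<close> across the cut makes \<open>a\<close>,
  \<open>Max S\<close>, \<open>b\<close> the one occurrence, and every deviation from the claimed
  shape would produce a second one.\<close>

lemma one_set_not_separated:
  assumes xs: "L @ Max S # R \<in> one_set (Suc k) S"
    and T: "set L \<union> set R = S - {Max S}" "set L \<inter> set R = {}" "distinct L" "distinct R"
    and ab: "a \<in> set L" "b \<in> set R" "a < b"
  obtains L' where "L = L' @ [a]" "L' \<in> avoid_set k (set L')" "R \<in> avoid_set (Suc k) (set R)"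
    "\<forall>l\<in>set L'. a < l \<and> (\<forall>r\<in>set R. r < l)" "\<forall>r\<in>set R - {b}. r < a"
proof -
  have M: "\<forall>x\<in>set L \<union> set R. x < Max S"
    using less_Max_Diff[OF S(1) T(1)] .
  note occ = occ_132_append_Cons_max[OF M]
  have "(a, Max S, b) \<in> occ_132 (L @ Max S # R)" unfolding occ using ab by simp
  moreover have "card (occ_132 (L @ Max S # R)) = 1" using xs by (simp add: one_set_def)
  ultimately have single: "occ_132 (L @ Max S # R) = {(a, Max S, b)}"
    by (metis card_1_singletonE singletonD)
  have "occ_132 L \<subseteq> {(a, Max S, b)}" "occ_132 R \<subseteq> {(a, Max S, b)}"
    using single unfolding occ by blast+
  then have no: "occ_132 L = {}" "occ_132 R = {}"
    using M occ_132_set[of a "Max S" b L] occ_132_set[of a "Max S" b R] by blast+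
  have uniq: "l = a \<and> r = b" if "l \<in> set L" "r \<in> set R" "l < r" for l r
  proof -
    have "(l, Max S, r) \<in> occ_132 (L @ Max S # R)" unfolding occ using that by simp
    then show ?thesis unfolding single by simp
  qed
  \<comment> \<open>Otherwise \<open>l\<close>, \<open>Max S\<close>, \<open>b\<close> would be
    another occurrence; the next fact follows in the same way from \<open>a\<close>,
    \<open>Max S\<close>, \<open>r\<close>.\<close>
  have big: "b < l" if "l \<in> set L" "l \<noteq> a" for l
    using uniq[OF that(1) ab(2)] that ab T(2) by (metis disjoint_iff linorder_neqE)
  have Rb: "\<forall>r\<in>set R - {b}. r < a"
    using uniq[OF ab(1)] ab T(2) by (metis DiffE disjoint_iff insertI1 linorder_neqE)
  obtain L1 L2 where L12: "L = L1 @ a # L2" using ab(1) by (meson split_list)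
  \<comment> \<open>A letter \<open>c\<close> after \<open>a\<close> in \<open>L\<close> exceeds
    \<open>b\<close>, so \<open>a\<close>, \<open>c\<close>, \<open>b\<close> would be an occurrence
    whose 3 is not the maximum.\<close>
  have "L2 = []"
  proof (rule ccontr)
    assume "L2 \<noteq> []"
    then obtain c where c: "c \<in> set L2" by (cases L2) auto
    then have "b < c" using T(3) by (intro big) (auto simp: L12)
    moreover have "subseq [a, c] L"
      using c subseq_pair_append[of a c "L1 @ [a]" L2] by (simp add: L12)
    ultimately have "(a, c, b) \<in> occ_132 (L @ Max S # R)"
      unfolding occ using ab by simp
    then have "c = Max S" unfolding single by simp
    with c M show False by (auto simp: L12)
  qed
  with L12 have L: "L = L1 @ [a]" by simp
  have L1: "\<forall>l\<in>set L1. a < l \<and> (\<forall>r\<in>set R. r < l)"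
  proof (intro ballI conjI)
    fix l assume l: "l \<in> set L1"
    then have "b < l" using T(3) by (intro big) (auto simp: L)
    with ab show "a < l" by simp
    fix r assume "r \<in> set R"
    with Rb \<open>b < l\<close> \<open>a < l\<close> show "r < l" by (cases "r = b") (auto intro: less_trans)
  qed
  have "\<not> contains_inc (Suc k) (L @ Max S # R)" using xs by (simp add: one_set_def)
  moreover have "contains_inc (Suc k) (L @ Max S # R) \<longleftrightarrow> contains_inc k L \<or> contains_inc (Suc k) R"
  proof (intro contains_inc_append_Cons_max k M)
    fix p x y s r assume *: "L = p @ x # y # s" "x < y" "r \<in> set R"
    have "x \<in> set (L1 @ [a])" "y \<in> set (L1 @ [a])" unfolding L[symmetric] * by simp_all
    with *(2) L1 have "y \<in> set L1" by auto
    with L1 *(3) show "r < y" by blast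
  qed
  moreover have "contains_inc k L \<longleftrightarrow> contains_inc k L1"
    unfolding L using L1 by (intro contains_inc_snoc_min) auto
  moreover have "occ_132 L1 = {}"
    using no(1) L1 occ_132_snoc_min[of L1 a] by (simp add: L)
  ultimately have "L1 \<in> avoid_set k (set L1)" "R \<in> avoid_set (Suc k) (set R)"
    using no(2) T(3,4) by (auto simp: avoid_set_def permutations_of_set_def L)
  with that L L1 Rb show ?thesis by blast
qed

lemma one_set_Suc:
  "one_set (Suc k) S =
     (\<lambda>(L, R). L @ Max S # R) ` split_pairs (one_set k) (avoid_set (Suc k)) (S - {Max S}) \<union>
     (\<lambda>(L, R). L @ Max S # R) ` split_pairs (avoid_set k) (one_set (Suc k)) (S - {Max S}) \<union>
     (\<lambda>(L, R). L @ hd R # Max S # tl R) ` split_pairs (avoid_set k) (cross_set (Suc k)) (S - {Max S})"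
  (is "_ = ?j ` ?A \<union> ?j ` ?B \<union> ?c ` ?C")
proof (intro equalityI subsetI)
  fix xs assume xs: "xs \<in> one_set (Suc k) S"
  then have "xs \<in> permutations_of_set S" using one_set_subset by blast
  then obtain L R where LR: "xs = L @ Max S # R" "set L \<inter> set R = {}" "set L \<union> set R = S - {Max S}"
      "distinct L" "distinct R"
    using permutations_of_set_split_max[OF S] by metis
  show "xs \<in> ?j ` ?A \<union> ?j ` ?B \<union> ?c ` ?C"
  proof (cases "\<forall>l\<in>set L. \<forall>r\<in>set R. r < l")
    case True
    then have "(L, R) \<in> ?A \<union> ?B"
      using xs LR separated_iff(2)[OF LR(3) True] by (simp add: split_pairs_def)
    then show ?thesis using LR(1) by (auto intro: image_eqI[of _ _ "(L, R)"])
  next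
    case False
    then obtain a b where ab: "a \<in> set L" "b \<in> set R" "a < b"
      using LR(2) by (metis disjoint_iff linorder_neqE)
    obtain L' where L': "L = L' @ [a]" "L' \<in> avoid_set k (set L')" "R \<in> avoid_set (Suc k) (set R)"
        "\<forall>l\<in>set L'. a < l \<and> (\<forall>r\<in>set R. r < l)" "\<forall>r\<in>set R - {b}. r < a"
      using one_set_not_separated[OF xs[unfolded LR(1)] LR(3,2,4,5) ab] by metis
    have "a # R \<in> cross_set (Suc k) (set (a # R))"
      unfolding cross_set_def using L' ab LR(2) by auto
    then have "(L', a # R) \<in> ?C"
      using L' LR(3) by (auto simp: split_pairs_def)
    then have "?c (L', a # R) \<in> ?c ` ?C" by (rule imageI)
    then show ?thesis by (simp add: LR(1) L'(1))
  qed
next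
  fix xs assume "xs \<in> ?j ` ?A \<union> ?j ` ?B \<union> ?c ` ?C"
  then consider (sep) L R where "xs = L @ Max S # R" "(L, R) \<in> ?A \<union> ?B"
    | (cross) L R where "xs = L @ hd R # Max S # tl R" "(L, R) \<in> ?C"
    by auto
  then show "xs \<in> one_set (Suc k) S"
  proof cases
    case sep
    then have "set L \<union> set R = S - {Max S}" "\<forall>l\<in>set L. \<forall>r\<in>set R. r < l"
      "L \<in> one_set k (set L) \<and> R \<in> avoid_set (Suc k) (set R) \<or>
       L \<in> avoid_set k (set L) \<and> R \<in> one_set (Suc k) (set R)"
      by (auto simp: split_pairs_def)
    then show ?thesis using separated_iff(2) sep(1) by simp
  next
    case cross
    then obtain a R' b where "R = a # R'" "a \<notin> set R'" "R' \<in> avoid_set (Suc k) (set R')"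
      "b \<in> set R'" "a < b" "\<forall>r\<in>set R' - {b}. r < a"
      by (auto simp: split_pairs_def cross_set_def)
    with cross show ?thesis
      using crossing_in_one_set[of L a R' b] by (simp add: split_pairs_def)
  qed
qed

lemma inj_on_append_Cons_max:
  "inj_on (\<lambda>(L, R). L @ Max S # R) {(L, R). set L \<union> set R = S - {Max S}}"
proof (rule inj_onI)
  fix v w
  assume v: "v \<in> {(L, R). set L \<union> set R = S - {Max S}}" and w: "w \<in> {(L, R). set L \<union> set R = S - {Max S}}"
    and eq: "(\<lambda>(L, R). L @ Max S # R) v = (\<lambda>(L, R). L @ Max S # R) w"
  obtain L R L' R' where vw: "v = (L, R)" "w = (L', R')" by fastforce
  from v have "Max S \<notin> set L" "Max S \<notin> set R" by (auto simp: vw)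
  with eq show "v = w" by (simp add: vw append_Cons_eq_iff)
qed

lemma card_avoid_set_Suc:
  "card (avoid_set (Suc k) S) = card (split_pairs (avoid_set k) (avoid_set (Suc k)) (S - {Max S}))"
  unfolding avoid_set_Suc
  by (intro card_image inj_on_subset[OF inj_on_append_Cons_max]) (auto simp: split_pairs_def)

lemma card_one_set_Suc:
  "card (one_set (Suc k) S) = card (split_pairs (one_set k) (avoid_set (Suc k)) (S - {Max S})) +
     card (split_pairs (avoid_set k) (one_set (Suc k)) (S - {Max S})) +
     card (split_pairs (avoid_set k) (cross_set (Suc k)) (S - {Max S}))"
proof -
  let ?A = "split_pairs (one_set k) (avoid_set (Suc k)) (S - {Max S})"
  let ?B = "split_pairs (avoid_set k) (one_set (Suc k)) (S - {Max S})"
  let ?C = "split_pairs (avoid_set k) (cross_set (Suc k)) (S - {Max S})"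
  let ?D = "{(L, R). set L \<union> set R = S - {Max S}}"
  let ?j = "\<lambda>(L, R). L @ Max S # R" and ?c = "\<lambda>(L, R). L @ hd R # Max S # tl R"
  \<comment> \<open>This decodes a crossing pair into the actual two sides of the maximum. One
    joining map then serves all three families, and its injectivity reduces the count to
    disjointness before joining.\<close>
  let ?u = "\<lambda>(L, R). (L @ [hd R], tl R)"
  have c_eq: "?c = ?j \<circ> ?u" by auto
  have C_Cons: "\<exists>a R'. R = a # R' \<and> (\<exists>b\<in>set R'. a < b)" if "(L, R) \<in> ?C" for L R
    using that by (auto simp: split_pairs_def cross_set_def)
  have inj_u: "inj_on ?u ?C"
    by (rule inj_onI) (auto dest!: C_Cons)
  have sub: "?A \<subseteq> ?D" "?B \<subseteq> ?D" by (auto simp: split_pairs_def)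
  have sub_u: "?u ` ?C \<subseteq> ?D"
  proof
    fix v assume "v \<in> ?u ` ?C"
    then obtain L R where LR: "v = ?u (L, R)" "(L, R) \<in> ?C" by auto
    from C_Cons[OF LR(2)] obtain a R' where "R = a # R'" by blast
    with LR show "v \<in> ?D" by (auto simp: split_pairs_def)
  qed
  have AB: "?A \<inter> ?B = {}"
    by (auto simp: split_pairs_def one_set_def avoid_set_def)
  \<comment> \<open>Decoded crossing pairs have \<open>a < b\<close> across the cut, whereas the
    pairs of the other two families are separated.\<close>
  have u: "(?A \<union> ?B) \<inter> ?u ` ?C = {}"
  proof -
    have "(L @ [hd R], tl R) \<notin> ?A \<union> ?B" if "(L, R) \<in> ?C" for L R
    proof -
      from C_Cons[OF that] obtain a b R' where "R = a # R'" "b \<in> set R'" "a < b" by blast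
      then show ?thesis by (auto simp: split_pairs_def dest: less_asym)
    qed
    then show ?thesis by auto
  qed
  have eq: "one_set (Suc k) S = ?j ` (?A \<union> ?B \<union> ?u ` ?C)"
    unfolding one_set_Suc c_eq image_comp[symmetric] image_Un ..
  have inj: "inj_on ?j (?A \<union> ?B \<union> ?u ` ?C)"
    using sub sub_u by (intro inj_on_subset[OF inj_on_append_Cons_max]) blast
  have "finite (one_set (Suc k) S)"
    using one_set_subset finite_permutations_of_set by (rule finite_subset)
  then have fin: "finite (?A \<union> ?B \<union> ?u ` ?C)"
    unfolding eq using inj by (rule finite_imageD)
  have "card (one_set (Suc k) S) = card (?A \<union> ?B \<union> ?u ` ?C)"
    unfolding eq using inj by (rule card_image)
  also have "\<dots> = card ?A + card ?B + card (?u ` ?C)"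
    using fin u AB by (simp add: card_Un_disjoint)
  also have "card (?u ` ?C) = card ?C" using inj_u by (rule card_image)
  finally show ?thesis .
qed

end

text \<open>The conditions force \<open>b\<close> to be the largest and \<open>a\<close> the second
  largest letter, so only the arrangement of the letters other than \<open>a\<close> is
  free.\<close>

lemma cross_set_eq:
  fixes E :: "'a::linorder set"
  assumes "finite E" "card E \<ge> 2"
  defines "a \<equiv> Max (E - {Max E})"
  shows "cross_set k E = (#) a ` avoid_set k (E - {a})"
proof -
  have "E \<noteq> {}" using assms(2) by auto
  then have m: "Max E \<in> E" using assms(1) by simp
  have "card (E - {Max E}) \<noteq> 0" using assms(1,2) m by simp
  then have ne: "E - {Max E} \<noteq> {}" by (metis card.empty)
  then have a: "a \<in> E" "a \<noteq> Max E" using Max_in[of "E - {Max E}"] assms(1) by (auto simp: a_def)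
  have le: "e \<le> a" if "e \<in> E" "e \<noteq> Max E" for e
    using that assms(1) by (auto simp: a_def)
  show ?thesis
  proof (intro equalityI subsetI)
    fix xs assume "xs \<in> cross_set k E"
    then obtain a' R b where xs: "xs = a' # R" "a' \<notin> set R" "insert a' (set R) = E"
      "R \<in> avoid_set k (set R)" "b \<in> set R" "a' < b" "\<forall>r\<in>set R - {b}. r < a'"
      by (auto simp: cross_set_def)
    have "Max E = b"
    proof (rule Max_eqI[OF assms(1)])
      fix y assume "y \<in> E"
      then show "y \<le> b" using xs(3,6,7) by (cases "y = b") (auto intro: less_imp_le less_trans)
    qed (use xs in auto)
    have "a = a'"
      unfolding a_def \<open>Max E = b\<close>
    proof (rule Max_eqI)
      fix y assume "y \<in> E - {b}"
      then show "y \<le> a'" using xs(3,7) by (auto intro: less_imp_le)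
    qed (use assms(1) xs in auto)
    moreover have "set R = E - {a'}" using xs by auto
    ultimately show "xs \<in> (#) a ` avoid_set k (E - {a})" using xs by auto
  next
    fix xs assume "xs \<in> (#) a ` avoid_set k (E - {a})"
    then obtain R where R: "xs = a # R" "R \<in> avoid_set k (E - {a})" by blast
    then have set: "set R = E - {a}"
      using avoid_set_subset permutations_of_setD(1) by blast
    have "a < Max E" using a assms(1) by (simp add: less_le)
    moreover have "\<forall>r\<in>set R - {Max E}. r < a" using le by (auto simp: set less_le)
    moreover have "Max E \<in> set R" using m a by (simp add: set)
    ultimately show "xs \<in> cross_set k E"
      unfolding cross_set_def using R set a(1) by auto
  qed
qed

lemma cross_set_eq_empty:
  assumes "finite E" "card E < 2"
  shows "cross_set k E = {}"
proof (rule ccontr)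
  assume "cross_set k E \<noteq> {}"
  then obtain a b where "a \<in> E" "b \<in> E" "a < b"
    by (auto simp: cross_set_def)
  then have "card {a, b} \<le> card E" using assms(1) by (intro card_mono) auto
  with \<open>a < b\<close> assms(2) show False by simp
qed

section \<open>Base cases: the empty word and the pattern 12\<close>

lemma occ_132_Nil: "occ_132 [] = {}"
  by (auto simp: occ_132_def)

lemma avoid_set_empty: "avoid_set k {} = {[]}"
  and one_set_empty: "one_set k {} = {}"
  by (auto simp: avoid_set_def one_set_def occ_132_Nil contains_inc_def)

lemma avoid_fps_nth_0: "avoid_fps (Suc k) $ 0 = 1"
  by (subst avoid_fps_eq) simp

lemma not_contains_inc_2: "\<not> contains_inc 2 xs \<longleftrightarrow> sorted_wrt (\<ge>) xs"
proof -
  have "contains_inc 2 xs \<longleftrightarrow> (\<exists>p a b s. xs = p @ a # b # s \<and> a < b)"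
    unfolding contains_inc_def by force
  also have "\<dots> \<longleftrightarrow> \<not> successively (\<ge>) xs"
    unfolding successively_conv_nth
  proof
    assume "\<exists>p a b s. xs = p @ a # b # s \<and> a < b"
    then obtain p a b s where *: "xs = p @ a # b # s" "a < b" by blast
    then show "\<not> (\<forall>i. Suc i < length xs \<longrightarrow> xs ! Suc i \<le> xs ! i)"
      by (auto simp: nth_append intro!: exI[of _ "length p"])
  next
    assume "\<not> (\<forall>i. Suc i < length xs \<longrightarrow> xs ! Suc i \<le> xs ! i)"
    then obtain i where i: "Suc i < length xs" "xs ! i < xs ! Suc i" by (auto simp: not_le)
    then have "xs = take i xs @ xs ! i # xs ! Suc i # drop (Suc (Suc i)) xs"
      by (simp add: Cons_nth_drop_Suc)
    with i show "\<exists>p a b s. xs = p @ a # b # s \<and> a < b" by blast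
  qed
  also have "successively (\<ge>) xs \<longleftrightarrow> sorted_wrt (\<ge>) xs"
    by (rule successively_conv_sorted_wrt) (auto simp: transp_def)
  finally show ?thesis by simp
qed

lemma occ_132_empty_if_decreasing:
  assumes "sorted_wrt (\<ge>) xs"
  shows "occ_132 xs = {}"
proof -
  have "sorted_wrt (\<ge>) ys" if "subseq ys xs" for ys
    using that assms by (induction rule: list_emb.induct) (auto dest: subseq_set_subset)
  then have "sorted_wrt (\<ge>) [a, c, b]" if "subseq [a, c, b] xs" for a b c
    using that by blast
  then show ?thesis by (fastforce simp: occ_132_def)
qed

lemma card_avoid_set_2:
  assumes "finite S"
  shows "card (avoid_set 2 S) = 1"
proof -
  have "avoid_set 2 S = {rev (sorted_list_of_set S)}"
  proof (intro equalityI subsetI)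
    fix xs assume "xs \<in> avoid_set 2 S"
    then have "sorted (rev xs)" "set (rev xs) = S" "distinct (rev xs)"
      by (auto simp: avoid_set_def not_contains_inc_2 permutations_of_set_def sorted_wrt_rev)
    then have "sorted_list_of_set S = rev xs"
      by (metis sorted_list_of_set.idem_if_sorted_distinct)
    then show "xs \<in> {rev (sorted_list_of_set S)}" by simp
  next
    fix xs assume "xs \<in> {rev (sorted_list_of_set S)}"
    moreover have "sorted_wrt (\<ge>) (rev (sorted_list_of_set S))"
      by (simp add: sorted_wrt_rev)
    ultimately show "xs \<in> avoid_set 2 S"
      using assms by (auto simp: avoid_set_def not_contains_inc_2 permutations_of_set_def
          occ_132_empty_if_decreasing)
  qed
  then show ?thesis by simp
qed

lemma one_set_2: "one_set 2 S = {}"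
  by (auto simp: one_set_def not_contains_inc_2 occ_132_empty_if_decreasing)

section \<open>The counts as coefficients\<close>

lemma card_avoid_set:
  assumes "k \<ge> 2" "finite S"
  shows "real (card (avoid_set k S)) = avoid_fps k $ card S"
  using assms
proof (induction k arbitrary: S rule: dec_induct)
  case base
  then show ?case by (simp add: card_avoid_set_2 avoid_fps_2_nth)
next
  case (step k)
  \<comment> \<open>The outer hypothesis handles the left factor with \<open>k\<close>. The right
    factor keeps \<open>Suc k\<close> but has fewer letters, so an inner induction on the number of
    letters is needed.\<close>
  note IHk = step.IH
  from \<open>finite S\<close> show ?case
  proof (induction "card S" arbitrary: S rule: less_induct)
    case less
    show ?case
    proof (cases "S = {}")
      case True
      then show ?thesis by (simp add: avoid_set_empty avoid_fps_nth_0)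
    next
      case False
      let ?T = "S - {Max S}"
      have card: "card S = Suc (card ?T)"
        using False less.prems by (metis Max_in card.remove)
      have IH: "real (card (avoid_set (Suc k) U)) = avoid_fps (Suc k) $ card U" if "U \<subseteq> ?T" for U
      proof (rule less.hyps)
        show "finite U" using that less.prems by (auto intro: finite_subset)
        show "card U < card S" using card_mono[OF _ that] card less.prems by simp
      qed
      have fin: "finite ?T" "\<And>U. U \<subseteq> ?T \<Longrightarrow> finite U"
        using less.prems by (auto intro: finite_subset)
      have "real (card (avoid_set (Suc k) S)) = (avoid_fps k * avoid_fps (Suc k)) $ card ?T"
        unfolding card_avoid_set_Suc[OF less.prems False step.hyps(1)]
        by (intro card_split_pairs avoid_set_subset fin IH IHk)
      also have "\<dots> = avoid_fps (Suc k) $ card S"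
        by (subst (2) avoid_fps_eq) (simp add: card)
      finally show ?thesis .
    qed
  qed
qed

text \<open>The factor \<open>fps_X\<close> stands for the forced letter \<open>a\<close>;
  subtracting 1 excludes the empty rest, which has no room for \<open>b\<close>.\<close>

lemma card_cross_set:
  assumes "k \<ge> 2" "finite E"
  shows "real (card (cross_set k E)) = (fps_X * (avoid_fps k - 1)) $ card E"
proof (cases "card E \<ge> 2")
  case True
  let ?a = "Max (E - {Max E})"
  have "E - {Max E} \<noteq> {}"
  proof
    assume "E - {Max E} = {}"
    then have "card E \<le> card {Max E}" by (intro card_mono) auto
    with True show False by simp
  qed
  then have "?a \<in> E" using Max_in[of "E - {Max E}"] assms(2) by auto
  then have card: "card (E - {?a}) = card E - 1" using assms(2) by simp
  have "card (cross_set k E) = card (avoid_set k (E - {?a}))"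
    unfolding cross_set_eq[OF assms(2) True] by (intro card_image) simp
  with True show ?thesis
    using card_avoid_set[OF assms(1), of "E - {?a}"] assms(2) by (auto simp: card)
next
  case False
  obtain k' where k: "k = Suc k'" using assms(1) by (cases k) auto
  \<comment> \<open>For one letter the coefficient is the constant term of
    \<open>avoid_fps k - 1\<close>, which vanishes.\<close>
  from False have "card E = 0 \<or> card E = 1" by auto
  then show ?thesis
    using cross_set_eq_empty[OF assms(2), of k] False avoid_fps_nth_0[of k']
    by (auto simp: k)
qed

lemma card_one_set:
  assumes "k \<ge> 2" "finite S"
  shows "real (card (one_set k S)) = one_fps k $ card S"
  using assms
proof (induction k arbitrary: S rule: dec_induct)
  case base
  then show ?case by (simp add: one_set_2 one_fps.simps)
next
  case (step k)
  note IHk = step.IH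
  from \<open>finite S\<close> show ?case
  proof (induction "card S" arbitrary: S rule: less_induct)
    case less
    show ?case
    proof (cases "S = {}")
      case True
      then show ?thesis by (simp add: one_set_empty one_fps.simps[of "Suc k"])
    next
      case False
      let ?T = "S - {Max S}"
      have card: "card S = Suc (card ?T)"
        using False less.prems by (metis Max_in card.remove)
      have IH: "real (card (one_set (Suc k) U)) = one_fps (Suc k) $ card U" if "U \<subseteq> ?T" for U
      proof (rule less.hyps)
        show "finite U" using that less.prems by (auto intro: finite_subset)
        show "card U < card S" using card_mono[OF _ that] card less.prems by simp
      qed
      have fin: "finite ?T" "\<And>U. U \<subseteq> ?T \<Longrightarrow> finite U"
        using less.prems by (auto intro: finite_subset)
      have k: "Suc k \<ge> 2" using step.hyps(1) by simp
      have "real (card (split_pairs (one_set k) (avoid_set (Suc k)) ?T)) =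
          (one_fps k * avoid_fps (Suc k)) $ card ?T"
        by (intro card_split_pairs one_set_subset avoid_set_subset fin IHk card_avoid_set k)
      moreover have "real (card (split_pairs (avoid_set k) (one_set (Suc k)) ?T)) =
          (avoid_fps k * one_fps (Suc k)) $ card ?T"
        by (intro card_split_pairs one_set_subset avoid_set_subset fin IH card_avoid_set step.hyps(1))
      moreover have "real (card (split_pairs (avoid_set k) (cross_set (Suc k)) ?T)) =
          (avoid_fps k * (fps_X * (avoid_fps (Suc k) - 1))) $ card ?T"
        by (intro card_split_pairs cross_set_subset avoid_set_subset fin card_avoid_set card_cross_set
            step.hyps(1) k)
      moreover note arg_cong[OF one_fps_eq[OF step.hyps(1)], of "\<lambda>f. f $ card S"]
      ultimately show ?thesis
        unfolding card_one_set_Suc[OF less.prems False step.hyps(1)] by (simp add: card)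
    qed
  qed
qed

section \<open>Chebyshev polynomials\<close>

lemma Chebyshev_U_eqI:
  assumes "\<And>\<theta>. sin \<theta> \<noteq> 0 \<Longrightarrow> poly q (cos \<theta>) = sin (real (p + 1) * \<theta>) / sin \<theta>"
  shows "Chebyshev_U p = q"
  using Chebyshev_U_unique[of p] poly_Chebyshev_U_cos[of _ p] assms by blast

lemma Chebyshev_U_0: "Chebyshev_U 0 = 1"
  by (rule Chebyshev_U_eqI) simp

lemma Chebyshev_U_1: "Chebyshev_U (Suc 0) = [:0, 2:]"
  by (rule Chebyshev_U_eqI) (simp add: sin_double)

lemma Chebyshev_U_rec:
  "Chebyshev_U (Suc (Suc p)) = [:0, 2:] * Chebyshev_U (Suc p) - Chebyshev_U p"
proof (rule Chebyshev_U_eqI)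
  fix \<theta> :: real
  assume \<theta>: "sin \<theta> \<noteq> 0"
  have "real (Suc (Suc p) + 1) * \<theta> = real (Suc p + 1) * \<theta> + \<theta>"
    and "real (p + 1) * \<theta> = real (Suc p + 1) * \<theta> - \<theta>"
    by (simp_all add: algebra_simps)
  then have "sin (real (Suc (Suc p) + 1) * \<theta>) =
      2 * cos \<theta> * sin (real (Suc p + 1) * \<theta>) - sin (real (p + 1) * \<theta>)"
    by (simp only: sin_add sin_diff) simp
  with \<theta> show "poly ([:0, 2:] * Chebyshev_U (Suc p) - Chebyshev_U p) (cos \<theta>) =
      sin (real (Suc (Suc p) + 1) * \<theta>) / sin \<theta>"
    by (simp add: poly_Chebyshev_U_cos diff_divide_distrib del: of_nat_add of_nat_Suc)
qed

section \<open>Chebyshev values and generating functions as Laurent series\<close>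

lemma map_poly_fls_const_diff:
  "map_poly fls_const (p - q) = map_poly fls_const p - map_poly fls_const (q :: real poly)"
  by (rule poly_eqI) (simp add: coeff_map_poly fls_minus_const)

lemma U_at_0: "U_at 0 t = 1"
  by (simp add: U_at_def Chebyshev_U_0)

lemma U_at_1: "t \<noteq> 0 \<Longrightarrow> t * U_at (Suc 0) t = 1"
  by (simp add: U_at_def Chebyshev_U_1 map_poly_pCons)

text \<open>At \<open>1 / (2 * t)\<close> the factor \<open>2 x\<close> of the three-term recurrence
  becomes \<open>1 / t\<close>; multiplying by \<open>t\<close> clears it.\<close>

lemma U_at_rec: "t \<noteq> 0 \<Longrightarrow> t * U_at (Suc (Suc p)) t = U_at (Suc p) t - t * U_at p t"
  by (simp add: U_at_def Chebyshev_U_rec map_poly_fls_const_diff map_poly_pCons map_poly_smult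
      algebra_simps flip: fls_const_mult_const)

definition subst_sq :: "real fps \<Rightarrow> real fls" where
  "subst_sq f = fps_to_fls (f oo fps_X\<^sup>2)"

lemma subst_sq_simps [simp]:
  "subst_sq 0 = 0" "subst_sq 1 = 1" "subst_sq fps_X = fls_X\<^sup>2"
  "subst_sq (f + g) = subst_sq f + subst_sq g"
  "subst_sq (f - g) = subst_sq f - subst_sq g"
  "subst_sq (f * g) = subst_sq f * subst_sq g"
  by (simp_all add: subst_sq_def fps_compose_add_distrib fps_compose_sub_distrib
      fps_compose_mult_distrib fls_times_fps_to_fls fps_to_fls_power)

lemma subst_sq_power [simp]: "subst_sq (f ^ n) = subst_sq f ^ n"
  by (induction n) simp_all

text \<open>This is \<open>F_k = U_(k-1) / (t U_k)\<close> without division. Nonvanishing is carried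
  along in the induction, since each product equals the previous, nonzero value.\<close>

lemma U_at_avoid_fps:
  "U_at (Suc k) fls_X \<noteq> 0 \<and> fls_X * U_at (Suc k) fls_X * subst_sq (avoid_fps (Suc k)) = U_at k fls_X"
proof (induction k)
  case 0
  have "U_at (Suc 0) fls_X \<noteq> 0" using U_at_1[of fls_X] by auto
  then show ?case using U_at_1[of fls_X] by (simp add: U_at_0 avoid_fps.simps)
next
  case (Suc k)
  let ?U = "\<lambda>k. U_at k fls_X" and ?F = "\<lambda>k. subst_sq (avoid_fps k)"
  have "(1 - fps_X * avoid_fps (Suc k)) * avoid_fps (Suc (Suc k)) = 1"
    by (subst avoid_fps.simps(2)[of "Suc k"]) (simp add: inverse_mult_eq_1')
  then have "subst_sq ((1 - fps_X * avoid_fps (Suc k)) * avoid_fps (Suc (Suc k))) = subst_sq 1" by simp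
  then have 1: "(1 - fls_X\<^sup>2 * ?F (Suc k)) * ?F (Suc (Suc k)) = 1"
    by simp
  have "fls_X * ?U (Suc (Suc k)) = ?U (Suc k) - fls_X * ?U k"
    by (simp add: U_at_rec)
  also have "\<dots> = ?U (Suc k) * (1 - fls_X\<^sup>2 * ?F (Suc k))"
    using Suc.IH by (simp add: algebra_simps power2_eq_square)
  finally have 2: "fls_X * ?U (Suc (Suc k)) = ?U (Suc k) * (1 - fls_X\<^sup>2 * ?F (Suc k))" .
  then have 3: "fls_X * ?U (Suc (Suc k)) * ?F (Suc (Suc k)) = ?U (Suc k)"
    using 1 by (simp add: mult.assoc)
  moreover from this Suc.IH have "?U (Suc (Suc k)) \<noteq> 0" by auto
  ultimately show ?case by blast
qed

text \<open>Multiplying the recursion by \<open>U_k^2\<close> turns it into a telescoping sum. The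
  shift by 2 lets the induction start at the pattern 12 with an empty sum.\<close>

lemma U_at_one_fps:
  "(U_at (k + 2) fls_X)\<^sup>2 * subst_sq (one_fps (k + 2)) = fls_X\<^sup>2 * (\<Sum>j = 1..k. (U_at j fls_X)\<^sup>2)"
proof (induction k)
  case 0
  show ?case by (simp add: one_fps.simps)
next
  case (Suc k)
  let ?U = "\<lambda>k. U_at k fls_X" and ?F = "\<lambda>k. subst_sq (avoid_fps k)" and ?G = "subst_sq (one_fps (k + 2))"
  have a: "fls_X * ?U (k + 3) * ?F (k + 3) = ?U (k + 2)"
    and b: "fls_X * ?U (k + 2) * ?F (k + 2) = ?U (k + 1)"
    using U_at_avoid_fps[of "k + 2"] U_at_avoid_fps[of "k + 1"]
    by (simp_all add: numeral_3_eq_3 numeral_2_eq_2)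
  have "one_fps (k + 3) = fps_X * (avoid_fps (k + 3))\<^sup>2 * (one_fps (k + 2) + fps_X\<^sup>2 * (avoid_fps (k + 2))\<^sup>2)"
    by (subst one_fps.simps) simp
  then have "(?U (k + 3))\<^sup>2 * subst_sq (one_fps (k + 3)) =
      (?U (k + 3))\<^sup>2 * (fls_X\<^sup>2 * (?F (k + 3))\<^sup>2 * (?G + (fls_X\<^sup>2)\<^sup>2 * (?F (k + 2))\<^sup>2))"
    by simp
  \<comment> \<open>The factors are grouped so that \<open>a\<close> applies; in the next line one
    factor \<open>fls_X\<^sup>2\<close> is set aside so that \<open>b\<close> applies to the
    rest.\<close>
  also have "\<dots> = (fls_X * ?U (k + 3) * ?F (k + 3))\<^sup>2 * (?G + (fls_X\<^sup>2)\<^sup>2 * (?F (k + 2))\<^sup>2)"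
    by (simp add: power_mult_distrib mult_ac)
  also have "\<dots> = (?U (k + 2))\<^sup>2 * ?G + fls_X\<^sup>2 * (fls_X * ?U (k + 2) * ?F (k + 2))\<^sup>2"
    unfolding a by (simp add: power_mult_distrib algebra_simps power2_eq_square)
  also have "\<dots> = fls_X\<^sup>2 * (\<Sum>j = 1..Suc k. (?U j)\<^sup>2)"
    unfolding b Suc.IH by (simp add: algebra_simps)
  finally show ?case by (simp add: numeral_3_eq_3)
qed

theorem theorem4p1:
  fixes k :: nat
  assumes "k \<ge> 2"
  shows "fps_to_fls (H (pattern_12_3_dots k) oo fps_X\<^sup>2) =
           fls_X\<^sup>2 / (U_at k fls_X)\<^sup>2 * (\<Sum>j = 1..k - 2. (U_at j fls_X)\<^sup>2)"
proof -
  have "h (pattern_12_3_dots k) n = card (one_set k {1..n})" for n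
    unfolding h_def one_set_def
    by (intro arg_cong[of _ _ card] Collect_cong)
       (auto simp: avoids_pattern_12_3_dots_iff[OF assms] card_occurrences_1_3_2 permutations_of_set_def)
  moreover have "real (card (one_set k {1..n})) = one_fps k $ n" for n
    using card_one_set[OF assms, of "{1..n}"] by simp
  ultimately have H: "H (pattern_12_3_dots k) = one_fps k"
    unfolding H_def by (intro fps_ext) simp
  \<comment> \<open>This licenses dividing the telescoped identity by the square of
    \<open>U_at k fls_X\<close>.\<close>
  have "U_at k fls_X \<noteq> 0" using U_at_avoid_fps[of "k - 1"] assms by simp
  moreover have "(U_at k fls_X)\<^sup>2 * subst_sq (one_fps k) = fls_X\<^sup>2 * (\<Sum>j = 1..k - 2. (U_at j fls_X)\<^sup>2)"
    using U_at_one_fps[of "k - 2"] unfolding le_add_diff_inverse2[OF assms] .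
  ultimately show ?thesis
    unfolding H subst_sq_def[symmetric] by (simp add: field_simps)
qed

end
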